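(* Let $m\geqslant 2$ be an integer, $n=2^m-2$, and let $\mathbb{F}$ be the field with two elements. Let $L$ be the $(n+2)$-dimensional $\mathbb{F}$-vector space with basis $v(0),v(1),\dots,v(n-1),w,x$, equipped with the $\mathbb{F}$-bilinear product determined on basis elements by $$v(i)\cdot v(j)=\binom{j+1}{n-i}\,v(i\oplus j)\quad (0\leqslant i,j\leqslant n-1),$$ $$v(i)\cdot w=w\cdot v(i)=v(i+1)\quad (0\leqslant i\leqslant n-2),\qquad v(n-1)\cdot w=w\cdot v(n-1)=w,$$ $$v(i)\cdot x=x\cdot v(i)=0\quad (0\leqslant i\leqslant n-1),\qquad w\cdot x=x\cdot w=v(0),\qquad w\cdot w=x\cdot x=0,$$ where $i\oplus j$ denotes the unique element of $\{0,1,\dots,n-2\}$ congruent to $i+j$ modulo $n-1$. Then $L$ is a Lie algebra over $\mathbb{F}$.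
   Context: Binomial coefficients are read modulo 2 as elements of $\mathbb{F}$. A Lie algebra over $\mathbb{F}$ (characteristic 2) is a vector space with a bilinear product that is alternating ($a\cdot a=0$ for all $a$) and satisfies the Jacobi identity. *)

theory Defs
  imports Complex_Main "HOL-Library.Z2"
begin

text \<open>
  Vector spaces are subspaces \<open>L\<close> of an ambient vector space (possibly \<open>L = UNIV\<close>), so
  that the dimension of \<open>L\<close> may depend on a variable. Products are
  functions on the ambient type whose values matter only on \<open>L\<close>.
\<close>

definition bilinear_on ::
  "('k::field \<Rightarrow> 'a::ab_group_add \<Rightarrow> 'a) \<Rightarrow> 'a set \<Rightarrow> ('a \<Rightarrow> 'a \<Rightarrow> 'a) \<Rightarrow> bool" where
  "bilinear_on scale L prd \<longleftrightarrow>
     (\<forall>a\<in>L. \<forall>b\<in>L. prd a b \<in> L) \<and>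
     (\<forall>a\<in>L. \<forall>b\<in>L. \<forall>c\<in>L. prd (a + b) c = prd a c + prd b c) \<and>
     (\<forall>a\<in>L. \<forall>b\<in>L. \<forall>c\<in>L. prd a (b + c) = prd a b + prd a c) \<and>
     (\<forall>r. \<forall>a\<in>L. \<forall>b\<in>L. prd (scale r a) b = scale r (prd a b)) \<and>
     (\<forall>r. \<forall>a\<in>L. \<forall>b\<in>L. prd a (scale r b) = scale r (prd a b))"

locale lie_algebra = vector_space scale
  for scale :: "'k::field \<Rightarrow> 'a::ab_group_add \<Rightarrow> 'a"
    and L :: "'a set"
    and prd :: "'a \<Rightarrow> 'a \<Rightarrow> 'a" +
  assumes subspace_carrier: "subspace L"
    and bilinear: "bilinear_on scale L prd"
    and alternating: "a \<in> L \<Longrightarrow> prd a a = 0"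
    and jacobi: "a \<in> L \<Longrightarrow> b \<in> L \<Longrightarrow> c \<in> L \<Longrightarrow>
      prd (prd a b) c + prd (prd b c) a + prd (prd c a) b = 0"

end

theory Submission
  imports Defs
begin

text \<open>
  The algebra is the Zassenhaus algebra in disguise. In the divided power algebra with basis
  \<open>t\<^sup>(\<^sup>0\<^sup>), \<dots>, t\<^sup>(\<^sup>q\<^sup>-\<^sup>1\<^sup>)\<close>, where \<open>q = 2\<^sup>m\<close>, put \<open>u k = t\<^sup>(\<^sup>k\<^sup>) \<partial>\<close>. The commutators of these derivations are,
  modulo 2,
  \<open>u a \<cdot> u b = (binom (a+b-1) a + binom (a+b-1) b) u (a+b-1) = binom (a+b) a u (a+b-1)\<close>,
  with the reading \<open>u (-1) = 0\<close>. No vector beyond \<open>u (q-1)\<close> is needed: if \<open>a, b < q \<le> a + b\<close>, then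
  \<open>binom (a+b) a\<close> is even (\<open>even_choose_if_carry\<close>). The given basis corresponds to this one by \<open>w = u 0\<close>,
  \<open>v i = u (n - i)\<close> and \<open>x = u (q - 1)\<close>; the translation of the coefficients rests on
  \<open>binom (q-1-b) a \<equiv> binom (a+b) a\<close> modulo 2, a form of \<open>binom (-b-1) a = \<plusminus> binom (a+b) a\<close>
  (\<open>choose_reflect_parity\<close>).

  In the symmetric form of the product the Jacobi identity is a divisibility statement about
  multinomial coefficients. For \<open>s = a+b+c > 0\<close>, the vector \<open>(u a \<cdot> u b) \<cdot> u c\<close> is the multiple of
  \<open>u (s-2)\<close> with coefficient \<open>(a+b)/s\<close> times the trinomial coefficient of \<open>(a,b,c)\<close>, and the three cyclic
  shares \<open>(a+b)/s\<close>, \<open>(b+c)/s\<close>, \<open>(c+a)/s\<close> add up to 2 (\<open>jacobi_coefficients_even\<close>).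
  By trilinearity it suffices to know this on the basis
  (\<open>lie_algebra_if_generators\<close>).
\<close>

section \<open>Binomial coefficients modulo 2\<close>

text \<open>
  From \<open>k binom (2\<^sup>m) k = 2\<^sup>m binom (2\<^sup>m-1) (k-1)\<close>: an odd coefficient would force \<open>2\<^sup>m\<close> to divide \<open>k\<close>.
\<close>
lemma even_choose_power2:
  fixes k m :: nat
  assumes "0 < k" "k < 2 ^ m"
  shows "even ((2 ^ m) choose k)"
proof (rule ccontr)
  assume "odd ((2 ^ m) choose k)"
  then have "coprime (2 ^ m) ((2 ^ m :: nat) choose k)"
    by simp
  moreover have "k * ((2 ^ m) choose k) = 2 ^ m * ((2 ^ m - 1) choose (k - 1))"
    using assms times_binomial_minus1_eq by blast
  ultimately have "2 ^ m dvd k"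
    by (metis coprime_dvd_mult_left_iff dvd_triv_left)
  then show False
    using assms by (auto dest: dvd_imp_le)
qed

lemma odd_choose_power2_minus_1:
  fixes d m :: nat
  assumes "d < 2 ^ m"
  shows "odd ((2 ^ m - 1) choose d)"
  using assms
proof (induction d)
  case (Suc d)
  have "(2 ^ m) choose Suc d = ((2 ^ m - 1) choose d) + ((2 ^ m - 1) choose Suc d)"
    using binomial_Suc_Suc[of "2 ^ m - 1" d] by simp
  then show ?case
    using Suc even_choose_power2[of "Suc d" m] by fastforce
qed simp

text \<open>
  Modulo 2, both sides satisfy the same Pascal recursion in \<open>(e, d)\<close>, and both are odd
  on the borders \<open>e = 0\<close> and \<open>d = 0\<close>.
\<close>
lemma choose_reflect_parity:
  fixes d e m :: nat
  assumes "d < 2 ^ m" "e < 2 ^ m"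
  shows "even ((2 ^ m - 1 - e) choose d) \<longleftrightarrow> even ((d + e) choose d)"
  using assms
proof (induction e arbitrary: d)
  case 0
  then show ?case
    using odd_choose_power2_minus_1 by simp
next
  case (Suc e)
  note outer = Suc.IH
  show ?case
    using Suc.prems(1)
  proof (induction d)
    case (Suc d)
    have "2 ^ m - 1 - e = Suc (2 ^ m - 1 - Suc e)"
      using \<open>Suc e < 2 ^ m\<close> by simp
    then have "(2 ^ m - 1 - e) choose Suc d
        = ((2 ^ m - 1 - Suc e) choose d) + ((2 ^ m - 1 - Suc e) choose Suc d)"
      by simp
    moreover have "(Suc d + Suc e) choose Suc d
        = ((d + Suc e) choose d) + ((Suc d + e) choose Suc d)"
      by simp
    moreover have "even ((2 ^ m - 1 - e) choose Suc d) \<longleftrightarrow> even ((Suc d + e) choose Suc d)"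
      using Suc.prems \<open>Suc e < 2 ^ m\<close> by (intro outer) simp_all
    ultimately show ?case
      using Suc by (metis Suc_lessD even_add)
  qed simp
qed

text \<open>
  The sum in \<open>d + e\<close> produces a binary carry; after reflection the lower index exceeds the upper one.
\<close>
corollary even_choose_if_carry:
  fixes d e m :: nat
  assumes "d < 2 ^ m" "e < 2 ^ m" "2 ^ m \<le> d + e"
  shows "even ((d + e) choose d)"
proof -
  have "2 ^ m - 1 - e < d"
    using assms by simp
  then show ?thesis
    using choose_reflect_parity[OF assms(1,2)] by (simp add: binomial_eq_0)
qed

lemma trinomial_rotate:
  fixes a b c :: nat
  shows "((a + b) choose a) * ((a + b + c) choose c) = ((b + c) choose b) * ((a + b + c) choose a)"
proof -
  have "((a + b + c) choose (a + b)) * ((a + b) choose a)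
      = ((a + b + c) choose a) * ((a + b + c - a) choose (a + b - a))"
    by (rule choose_mult) simp_all
  moreover have "(a + b + c) choose (a + b) = (a + b + c) choose c"
    using binomial_symmetric[of c "a + b + c"] by simp
  ultimately show ?thesis
    by (simp add: mult.commute)
qed

text \<open>
  Multiplied by \<open>s = a + b + c\<close>, the summands become \<open>a + b\<close>, \<open>b + c\<close> and \<open>c + a\<close> times
  the trinomial coefficient \<open>M\<close>. Hence their sum is \<open>2 M\<close>.
\<close>
lemma jacobi_coefficients_even:
  fixes a b c :: nat
  assumes "a + b + c > 0"
  defines "s \<equiv> a + b + c"
  shows "even (((a + b) choose a) * ((s - 1) choose c)
             + ((b + c) choose b) * ((s - 1) choose a)
             + ((c + a) choose c) * ((s - 1) choose b))"
    (is "even (?A + ?B + ?C)")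
proof -
  define M where "M = ((a + b) choose a) * (s choose c)"
  have absorb: "s * ((s - 1) choose k) = (s - k) * (s choose k)" for k
    by (simp add: binomial_absorb_comp)
  have M2: "M = ((b + c) choose b) * (s choose a)"
    unfolding M_def s_def by (rule trinomial_rotate)
  have M3: "M = ((c + a) choose c) * (s choose b)"
    unfolding M2 s_def using trinomial_rotate[of b c a] by (simp add: ac_simps)
  have "s * ?A = (a + b) * M"
    using absorb[of c] by (simp add: M_def s_def ac_simps)
  moreover have "s * ?B = (b + c) * M"
    using absorb[of a] by (simp add: M2 s_def ac_simps)
  moreover have "s * ?C = (c + a) * M"
    using absorb[of b] by (simp add: M3 s_def ac_simps)
  ultimately have "s * (?A + ?B + ?C) = s * (2 * M)"
    unfolding s_def by algebra
  then have "?A + ?B + ?C = 2 * M"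
    using assms(1) unfolding s_def[symmetric] mult_cancel1 by blast
  then show ?thesis
    by simp
qed

section \<open>From generators to the Lie algebra axioms\<close>

text \<open>
  On sums of generators the alternating law needs more than squares:
  \<open>(a + b) \<cdot> (a + b)\<close> contains the mixed terms \<open>a \<cdot> b + b \<cdot> a\<close>, so anticommutativity of the
  generators is a separate hypothesis. The other two laws are linear in each argument.
\<close>
lemma lie_algebra_if_generators:
  fixes scale :: "'k::field \<Rightarrow> 'a::ab_group_add \<Rightarrow> 'a"
    and prd :: "'a \<Rightarrow> 'a \<Rightarrow> 'a"
  assumes vs: "vector_space scale"
    and L: "module.span scale B = L"
    and bil: "bilinear_on scale L prd"
    and sq: "\<And>b. b \<in> B \<Longrightarrow> prd b b = 0"
    and anti: "\<And>b c. b \<in> B \<Longrightarrow> c \<in> B \<Longrightarrow> prd b c + prd c b = 0"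
    and jac: "\<And>b c d. b \<in> B \<Longrightarrow> c \<in> B \<Longrightarrow> d \<in> B \<Longrightarrow>
      prd (prd b c) d + prd (prd c d) b + prd (prd d b) c = 0"
  shows "lie_algebra scale L prd"
proof -
  interpret vector_space scale by (rule vs)
  have sub: "subspace L"
    using L subspace_span by blast
  have BL: "b \<in> L" if "b \<in> B" for b
    using L span_base that by blast
  note [simp] = subspace_0[OF sub] subspace_add[OF sub] subspace_scale[OF sub]
  have cl [simp]: "prd a b \<in> L" if "a \<in> L" "b \<in> L" for a b
    using bil that unfolding bilinear_on_def by blast
  have [simp]: "prd (a + b) c = prd a c + prd b c" "prd c (a + b) = prd c a + prd c b"
    if "a \<in> L" "b \<in> L" "c \<in> L" for a b c
    using bil that unfolding bilinear_on_def by blast+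
  have [simp]: "prd (scale r a) c = scale r (prd a c)" "prd c (scale r a) = scale r (prd c a)"
    if "a \<in> L" "c \<in> L" for a c r
    using bil that unfolding bilinear_on_def by blast+
  have [simp]: "prd 0 a = 0" "prd a 0 = 0" if "a \<in> L" for a
    using that bil subspace_0[OF sub] unfolding bilinear_on_def
    by (metis scale_zero_left)+
  have anti1: "prd a c + prd c a = 0" if "c \<in> B" "a \<in> L" for a c
  proof -
    have "a \<in> span B" using that L by simp
    then have "a \<in> L \<and> prd a c + prd c a = 0"
    proof (induction rule: span_induct_alt)
      case (step r b y)
      have "prd (scale r b + y) c + prd c (scale r b + y)
          = scale r (prd b c + prd c b) + (prd y c + prd c y)"
        using step BL that by (simp add: scale_right_distrib algebra_simps)
      then show ?case
        using step BL that anti by simp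
    qed (use BL that in simp)
    then show ?thesis by simp
  qed
  have anti2: "prd a c + prd c a = 0" if "c \<in> L" "a \<in> L" for a c
  proof -
    have "c \<in> span B" using that L by simp
    then have "c \<in> L \<and> prd a c + prd c a = 0"
    proof (induction rule: span_induct_alt)
      case (step r b y)
      have "prd a (scale r b + y) + prd (scale r b + y) a
          = scale r (prd a b + prd b a) + (prd a y + prd y a)"
        using step BL that by (simp add: scale_right_distrib algebra_simps)
      then show ?case
        using step BL that anti1 by simp
    qed (use that in simp)
    then show ?thesis by simp
  qed
  have alt: "prd a a = 0" if "a \<in> L" for a
  proof -
    have "a \<in> span B" using that L by simp
    then have "a \<in> L \<and> prd a a = 0"
    proof (induction rule: span_induct_alt)
      case (step r b y)
      have "prd (scale r b + y) (scale r b + y)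
          = scale r (scale r (prd b b)) + scale r (prd b y + prd y b) + prd y y"
        using step BL by (simp add: scale_right_distrib algebra_simps)
      then show ?case
        using step BL sq anti2 by simp
    qed simp
    then show ?thesis by simp
  qed
  define J where "J a b c = prd (prd a b) c + prd (prd b c) a + prd (prd c a) b" for a b c
  have J_rotate: "J a b c = J b c a" for a b c
    by (simp add: J_def ac_simps)
  \<comment> \<open>Since \<open>J\<close> is invariant under rotation, only its first argument has to be extended
    from \<open>B\<close> to \<open>L\<close>; doing so three times covers all arguments.\<close>
  have J_extend: "J a b c = 0" if "\<And>d. d \<in> B \<Longrightarrow> J d b c = 0" "a \<in> L" "b \<in> L" "c \<in> L" for a b c
  proof -
    have "a \<in> span B" using that L by simp
    then have "a \<in> L \<and> J a b c = 0"
    proof (induction rule: span_induct_alt)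
      case base
      show ?case using that by (simp add: J_def)
    next
      case (step r d y)
      have "J (scale r d + y) b c = scale r (J d b c) + J y b c"
        using step BL that(3,4) by (simp add: J_def scale_right_distrib algebra_simps)
      then show ?case
        using step BL that by simp
    qed
    then show ?thesis by simp
  qed
  have J1: "J a b c = 0" if "a \<in> L" "b \<in> B" "c \<in> B" for a b c
    using that BL jac J_extend by (metis J_def)
  have J2: "J a b c = 0" if "a \<in> L" "b \<in> L" "c \<in> B" for a b c
    using that BL J1 J_extend J_rotate by metis
  have J3: "J a b c = 0" if "a \<in> L" "b \<in> L" "c \<in> L" for a b c
    using that BL J2 J_extend J_rotate by metis
  show ?thesis
    by unfold_locales (use sub bil alt J3 in \<open>auto simp: J_def\<close>)
qed

section \<open>The Zassenhaus algebra over the field with two elements\<close>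

lemma of_nat_bit_cong:
  assumes "even k \<longleftrightarrow> even l"
  shows "(of_nat k :: bit) = of_nat l"
  using assms by (simp only: Z2.bit_eq_iff even_of_nat)

text \<open>
  The basis is \<open>E 1, \<dots>, E q\<close>: the vector \<open>E (k + 1)\<close> stands for the derivation \<open>t\<^sup>(\<^sup>k\<^sup>) \<partial>\<close>. This shift lets
  \<open>E 0 = 0\<close> take care of \<open>\<partial> \<cdot> \<partial> = 0\<close>, where the binomial coefficient is 1. Vectors
  \<open>E k\<close> with \<open>k > q\<close> only occur with even coefficients, so nothing is said about them
  apart from membership in \<open>L\<close>.
\<close>
lemma lie_algebra_zassenhaus:
  fixes scale :: "bit \<Rightarrow> 'a::ab_group_add \<Rightarrow> 'a"
    and prd :: "'a \<Rightarrow> 'a \<Rightarrow> 'a"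
    and E :: "nat \<Rightarrow> 'a"
  assumes vs: "vector_space scale"
    and L: "module.span scale (E ` {1..2 ^ m}) = L"
    and bil: "bilinear_on scale L prd"
    and E0: "E 0 = 0" and EL: "\<And>k. E k \<in> L"
    and prod: "\<And>a b. a < 2 ^ m \<Longrightarrow> b < 2 ^ m \<Longrightarrow>
      prd (E (Suc a)) (E (Suc b)) = scale (of_nat ((a + b) choose a)) (E (a + b))"
  shows "lie_algebra scale L prd"
proof -
  interpret vector_space scale by (rule vs)
  have even0: "scale (of_nat k) y = 0" if "even k" for k y
    using of_nat_bit_cong[of k 0] that by simp
  have scl: "prd (scale r a) b = scale r (prd a b)" if "a \<in> L" "b \<in> L" for r a b
    using bil that unfolding bilinear_on_def by blast
  have zero: "prd 0 a = 0" if "a \<in> L" for a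
    using scl[of "E 0" a 0] EL that by simp
  have double: "y + y = 0" for y :: 'a
    using scale_left_distrib[of 1 1 y] by simp
  have triple: "prd (prd (E (Suc a)) (E (Suc b))) (E (Suc c))
      = scale (of_nat (((a + b) choose a) * ((a + b + c - 1) choose c))) (E (a + b + c - 1))"
    if "a < 2 ^ m" "b < 2 ^ m" "c < 2 ^ m" for a b c
  proof (cases "a + b = 0")
    case True
    \<comment> \<open>Here the left side vanishes. On the right, the second coefficient vanishes for
      \<open>c > 0\<close> and the vector is \<open>E 0\<close> for \<open>c = 0\<close>.\<close>
    then show ?thesis
      using prod[OF that(1,2)] EL E0 zero by (cases c) (auto simp: binomial_eq_0)
  next
    case False
    then obtain k where k: "a + b = Suc k"
      by (cases "a + b") auto
    have "prd (prd (E (Suc a)) (E (Suc b))) (E (Suc c))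
        = scale (of_nat ((a + b) choose a)) (prd (E (Suc k)) (E (Suc c)))"
      using prod[OF that(1,2)] scl EL k by simp
    also have "\<dots> = scale (of_nat (((a + b) choose a) * ((k + c) choose c))) (E (k + c))"
    proof (cases "a + b < 2 ^ m")
      case True
      then show ?thesis
        using prod[of k c] that k binomial_symmetric[of c "k + c"]
        by (simp only: scale_scale of_nat_mult) simp
    next
      case False
      then have "even ((a + b) choose a)"
        using even_choose_if_carry that by simp
      then show ?thesis
        by (simp only: even0 even_mult_iff simp_thms)
    qed
    finally show ?thesis
      using k by simp
  qed
  have comm: "prd (E (Suc a)) (E (Suc b)) = prd (E (Suc b)) (E (Suc a))"
    if "a < 2 ^ m" "b < 2 ^ m" for a b
  proof -
    have "(a + b) choose a = (a + b) choose b"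
      using binomial_symmetric[of a "a + b"] by simp
    then show ?thesis
      unfolding prod[OF that] prod[OF that(2,1)] add.commute[of b a] by (simp only:)
  qed
  have square: "prd (E (Suc a)) (E (Suc a)) = 0" if "a < 2 ^ m" for a
  proof (cases a)
    case (Suc k)
    \<comment> \<open>By Pascal's rule, \<open>binom (2 a) a\<close> is the sum of two coefficients, which are equal by symmetry.\<close>
    have "(Suc k + k) choose k = (Suc k + k) choose Suc k"
      using binomial_symmetric[of k "Suc k + k"] by simp
    then have "even ((a + a) choose a)"
      using Suc by simp
    then show ?thesis
      using prod[OF that that] by (simp only: even0)
  qed (use prod[of 0 0] E0 in simp)
  have jacobi: "prd (prd (E (Suc a)) (E (Suc b))) (E (Suc c))
      + prd (prd (E (Suc b)) (E (Suc c))) (E (Suc a))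
      + prd (prd (E (Suc c)) (E (Suc a))) (E (Suc b)) = 0"
    if "a < 2 ^ m" "b < 2 ^ m" "c < 2 ^ m" for a b c
  proof (cases "a + b + c = 0")
    case True
    then show ?thesis
      using prod[of 0 0] EL E0 zero by simp
  next
    case False
    define s where "s = a + b + c"
    have s: "b + c + a = s" "c + a + b = s" "a + b + c = s"
      by (simp_all add: s_def)
    show ?thesis
      unfolding triple[OF that] triple[OF that(2,3,1)] triple[OF that(3,1,2)] s
        scale_left_distrib[symmetric] of_nat_add[symmetric]
      using False by (intro even0 jacobi_coefficients_even[of a b c, folded s_def]) (simp add: s_def)
  qed
  have gens: "\<exists>k<2 ^ m. b = E (Suc k)" if "b \<in> E ` {1..2 ^ m}" for b
  proof -
    from that obtain l where "l \<in> {1..2 ^ m}" "b = E l"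
      by blast
    then show ?thesis
      by (intro exI[of _ "l - 1"]) auto
  qed
  show ?thesis
  proof (rule lie_algebra_if_generators[OF vs L bil])
    fix b c d
    assume "b \<in> E ` {1..2 ^ m}"
    then obtain k where k: "k < 2 ^ m" "b = E (Suc k)"
      using gens by blast
    show "prd b b = 0"
      unfolding k(2) using k(1) by (rule square)
    assume "c \<in> E ` {1..2 ^ m}"
    then obtain l where l: "l < 2 ^ m" "c = E (Suc l)"
      using gens by blast
    show "prd b c + prd c b = 0"
      unfolding k(2) l(2) comm[OF k(1) l(1)] by (rule double)
    assume "d \<in> E ` {1..2 ^ m}"
    then obtain r where r: "r < 2 ^ m" "d = E (Suc r)"
      using gens by blast
    show "prd (prd b c) d + prd (prd c d) b + prd (prd d b) c = 0"
      unfolding k(2) l(2) r(2) using k(1) l(1) r(1) by (rule jacobi)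
  qed
qed

theorem theorem2p1:
  fixes m n :: nat
    and scale :: "bit \<Rightarrow> 'a::ab_group_add \<Rightarrow> 'a"
    and L :: "'a set"
    and prd :: "'a \<Rightarrow> 'a \<Rightarrow> 'a" (infixl "\<odot>" 70)
    and v :: "nat \<Rightarrow> 'a" and w x :: 'a
  assumes "m \<ge> 2" and "n = 2 ^ m - 2"
    and "vector_space scale"
    and "inj_on v {0..<n}" and "w \<notin> v ` {0..<n}" and "x \<notin> v ` {0..<n}" and "w \<noteq> x"
    and "\<not> module.dependent scale (v ` {0..<n} \<union> {w, x})"
    and "module.span scale (v ` {0..<n} \<union> {w, x}) = L"
    and "bilinear_on scale L prd"
    and "\<And>i j. i < n \<Longrightarrow> j < n \<Longrightarrow>
           v i \<odot> v j = scale (of_nat ((j + 1) choose (n - i))) (v ((i + j) mod (n - 1)))"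
    and "\<And>i. i \<le> n - 2 \<Longrightarrow> v i \<odot> w = v (i + 1)"
    and "\<And>i. i \<le> n - 2 \<Longrightarrow> w \<odot> v i = v (i + 1)"
    and "v (n - 1) \<odot> w = w" and "w \<odot> v (n - 1) = w"
    and "\<And>i. i < n \<Longrightarrow> v i \<odot> x = 0" and "\<And>i. i < n \<Longrightarrow> x \<odot> v i = 0"
    and "w \<odot> x = v 0" and "x \<odot> w = v 0"
    and "w \<odot> w = 0" and "x \<odot> x = 0"
  shows "lie_algebra scale L prd"
proof -
  interpret vector_space scale by fact
  note vv = assms(11) and vw = assms(12) and wv = assms(13)
  have q: "2 ^ m = n + 2" and n2: "n \<ge> 2"
    using assms(1,2) power_increasing[of 2 m "2::nat"] by simp_all
  \<comment> \<open>\<open>E (k + 1)\<close> is \<open>t\<^sup>(\<^sup>k\<^sup>) \<partial>\<close>: the basis in the order \<open>w, v (n-1), \<dots>, v 0, x\<close>, padded by zeros.\<close>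
  define E where "E k = (if k = 0 then 0 else if k = 1 then w else if k \<le> n + 1 then v (n + 1 - k)
    else if k = n + 2 then x else 0)" for k
  have E0: "E 0 = 0" and Ew: "E 1 = w" and Ex: "E (n + 2) = x"
    by (simp_all add: E_def)
  have Ev: "E (Suc d) = v (n - d)" if "1 \<le> d" "d \<le> n" for d
    using that by (simp add: E_def)
  have basis: "E ` {1..2 ^ m} = v ` {0..<n} \<union> {w, x}"
  proof -
    have "{1..2 ^ m} = Suc ` {1..n} \<union> {1, n + 2}"
      by (auto simp: q image_iff)
    moreover have "E ` Suc ` {1..n} = (\<lambda>d. v (n - d)) ` {1..n}"
      unfolding image_image using Ev by (intro image_cong) auto
    moreover have "\<dots> = v ` {0..<n}"
    proof -
      have "(\<lambda>d. n - d) ` {1..n} = {0..<n}"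
      proof
        show "{0..<n} \<subseteq> (\<lambda>d. n - d) ` {1..n}"
        proof
          fix i assume "i \<in> {0..<n}"
          then show "i \<in> (\<lambda>d. n - d) ` {1..n}"
            by (intro image_eqI[of _ _ "n - i"]) auto
        qed
      qed auto
      then show ?thesis by (metis image_image)
    qed
    ultimately show ?thesis
      using Ew Ex by (simp add: image_Un)
  qed
  have EL: "E k \<in> L" for k
  proof (cases "k \<in> {1..2 ^ m}")
    case True
    then show ?thesis
      using basis assms(9) span_base by blast
  next
    case False
    then have "E k = 0"
      by (auto simp: E_def q)
    then show ?thesis
      using assms(9) span_zero by metis
  qed
  have even0: "scale (of_nat k) y = 0" if "even k" for k y
    using of_nat_bit_cong[of k 0] that by simp
  have carry: "scale (of_nat ((a + b) choose a)) y = 0" if "a < n + 2" "b < n + 2" "n + 2 \<le> a + b" for a b y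
    using even_choose_if_carry[of a m b] that q even0 by simp
  have middle: "v (n - a) \<odot> v (n - b) = scale (of_nat ((a + b) choose a)) (E (a + b))"
    if a: "1 \<le> a" "a \<le> n" and b: "1 \<le> b" "b \<le> n" for a b
  proof -
    have "n - b + 1 = 2 ^ m - 1 - b" "n - (n - a) = a"
      using q a b by simp_all
    then have "(of_nat ((n - b + 1) choose (n - (n - a))) :: bit) = of_nat ((a + b) choose a)"
      using choose_reflect_parity[of a m b] a b q by (intro of_nat_bit_cong) simp
    then have *: "v (n - a) \<odot> v (n - b)
        = scale (of_nat ((a + b) choose a)) (v ((n - a + (n - b)) mod (n - 1)))"
      using vv[of "n - a" "n - b"] a b by simp
    consider "n + 2 \<le> a + b" | "a = 1" "b = 1" | "2 < a + b" "a + b \<le> n + 1"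
      using a b by linarith
    then show ?thesis
    proof cases
      case 1
      then show ?thesis
        using * carry a b by simp
    next
      \<comment> \<open>The index of \<open>E 2 = v (n - 1)\<close> is missed by \<open>i \<oplus> j\<close>, which reduces it to 0, but the
        coefficient is 2.\<close>
      case 2
      then show ?thesis
        using * even0 by simp
    next
      case 3
      have "n - a + (n - b) = (n - 1) + (n + 1 - (a + b))"
        using 3 a b by simp
      moreover have "n + 1 - (a + b) < n - 1"
        using 3 by simp
      ultimately have "(n - a + (n - b)) mod (n - 1) = n + 1 - (a + b)"
        by (simp only: mod_add_self1 mod_less)
      moreover have "E (a + b) = v (n + 1 - (a + b))"
        using 3 by (auto simp: E_def)
      ultimately show ?thesis
        using * by simp
    qed
  qed
  have prod: "E (Suc a) \<odot> E (Suc b) = scale (of_nat ((a + b) choose a)) (E (a + b))"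
    if "a < 2 ^ m" "b < 2 ^ m" for a b
  proof -
    have vw': "v (n - d) \<odot> w = E d" "w \<odot> v (n - d) = E d" if "1 \<le> d" "d \<le> n" for d
    proof -
      have "v (n - d) \<odot> w = E d \<and> w \<odot> v (n - d) = E d"
      proof (cases "d = 1")
        case True
        then show ?thesis using assms(14,15) Ew by simp
      next
        case False
        then have "E d = v (n - d + 1)"
          using that by (simp add: E_def Suc_diff_le)
        then show ?thesis
          using vw[of "n - d"] wv[of "n - d"] that False by simp
      qed
      then show "v (n - d) \<odot> w = E d" "w \<odot> v (n - d) = E d" by simp_all
    qed
    have Ev0: "E (n + 1) = v 0"
      using n2 by (simp add: E_def)
    have low: "E (Suc 0) = w" and high: "E (Suc (n + 1)) = x"
      using Ew Ex by simp_all
    have "a = 0 \<or> 1 \<le> a \<and> a \<le> n \<or> a = n + 1" "b = 0 \<or> 1 \<le> b \<and> b \<le> n \<or> b = n + 1"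
      using that unfolding q by linarith+
    then consider "a = 0" "b = 0" | "a = 0" "1 \<le> b" "b \<le> n" | "a = 0" "b = n + 1"
      | "1 \<le> a" "a \<le> n" "b = 0" | "1 \<le> a" "a \<le> n" "1 \<le> b" "b \<le> n"
      | "a = n + 1" "b = 0" | "a = n + 1" "1 \<le> b" "b \<le> n"
      | "1 \<le> a" "a \<le> n" "b = n + 1" | "a = n + 1" "b = n + 1"
      by argo
    then show ?thesis
    proof cases
      case 1
      then show ?thesis by (simp only: low E0 \<open>w \<odot> w = 0\<close> add_0 scale_zero_right)
    next
      case 2
      then show ?thesis by (simp add: low Ev vw')
    next
      case 3
      then have "E (Suc a) \<odot> E (Suc b) = v 0"
        by (simp only: low high \<open>w \<odot> x = v 0\<close>)
      then show ?thesis
        using 3 Ev0 by simp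
    next
      case 4
      then show ?thesis by (simp add: low Ev vw')
    next
      case 5
      then show ?thesis by (simp only: Ev middle)
    next
      case 6
      then have "E (Suc a) \<odot> E (Suc b) = v 0"
        by (simp only: low high \<open>x \<odot> w = v 0\<close>)
      then show ?thesis
        using 6 Ev0 by simp
    next
      case 7
      then have "E (Suc a) \<odot> E (Suc b) = 0"
        using assms(17) by (simp only: Ev high)
      then show ?thesis
        using 7 carry[of a b] by simp
    next
      case 8
      then have "E (Suc a) \<odot> E (Suc b) = 0"
        using assms(16) by (simp only: Ev high)
      then show ?thesis
        using 8 carry[of a b] by simp
    next
      case 9
      then have "E (Suc a) \<odot> E (Suc b) = 0"
        by (simp only: high \<open>x \<odot> x = 0\<close>)
      then show ?thesis
        using 9 carry[of a b] n2 by simp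
    qed
  qed
  show ?thesis
    by (rule lie_algebra_zassenhaus[OF assms(3) _ assms(10) E0 EL prod])
      (use basis assms(9) in simp_all)
qed

end
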